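(* Let $X$ be a pre-Riesz space and let $a\in X$ be an atom. Then $a$ is a discrete element.
   Context: All vector spaces are real. An ordered vector space $X$ is a real vector space with a cone $X_+$ (closed under addition and multiplication by nonnegative scalars, $X_+\cap(-X_+)=\{0\}$), ordered by $x\le y$ iff $y-x\in X_+$. A linear subspace $D$ of an ordered vector space $Y$ is order dense in $Y$ if $y=\inf\{z\in D: y\le z\}$ for every $y\in Y$. An ordered vector space $X$ is a pre-Riesz space if there exist a vector lattice $Y$ and a bipositive linear map $i\colon X\to Y$ (i.e. $i(x)\ge 0$ iff $x\ge 0$) such that $i(X)$ is order dense in $Y$. For $M\subseteq X$, $M^u$ is the set of upper bounds of $M$ in $X$. Elements $x,y\in X$ are disjoint, $x\perp y$, if $\{x+y,-x-y\}^u=\{x-y,-x+y\}^u$. An element $a\in X_+\setminus\{0\}$ is an atom if $0\le x\le a$ implies $x=\lambda a$ for some real $\lambda\ge 0$. An element $a\in X$, $a>0$, is discrete if for all $x,z\in X_+$ with $x,z\le a$ and $x\perp z$ it follows that $x=0$ or $z=0$. *)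

theory Defs
  imports "HOL-Library.Lub_Glb"
begin

text \<open>
  An ordered vector space is a type of class \<^class>\<open>ordered_real_vector\<close>, with positive
  cone \<open>{x. 0 \<le> x}\<close>; a vector lattice is a type that is moreover of class \<^class>\<open>lattice\<close>.
\<close>

definition order_dense :: "'a::ordered_real_vector set \<Rightarrow> bool" where
  "order_dense D \<longleftrightarrow> subspace D \<and> (\<forall>y. isGlb UNIV {z \<in> D. y \<le> z} y)"

definition bipositive :: "('a::ordered_real_vector \<Rightarrow> 'b::ordered_real_vector) \<Rightarrow> bool" where
  "bipositive i \<longleftrightarrow> (\<forall>x. 0 \<le> i x \<longleftrightarrow> 0 \<le> x)"

text \<open>
  HOL cannot quantify existentially over types, so the vector lattice \<open>'y\<close> in which \<open>'x\<close>
  embeds is a parameter: \<open>'x\<close> is a pre-Riesz space if \<open>pre_Riesz_space TYPE('x) TYPE('y)\<close>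
  holds for some \<open>'y\<close>.  As an assumption of a theorem in which \<open>'y\<close> is an otherwise
  unconstrained type variable, it expresses exactly that existential hypothesis.
\<close>

definition pre_Riesz_space ::
    "'x::ordered_real_vector itself \<Rightarrow> 'y::{ordered_real_vector,lattice} itself \<Rightarrow> bool" where
  "pre_Riesz_space X Y \<longleftrightarrow>
     (\<exists>i :: 'x \<Rightarrow> 'y. linear i \<and> bipositive i \<and> order_dense (range i))"

text \<open>\<open>ubs UNIV M\<close> is the set of all upper bounds of \<open>M\<close>, written \<open>M\<^sup>u\<close> in the literature.\<close>

definition disjoint_elements :: "'a::ordered_real_vector \<Rightarrow> 'a \<Rightarrow> bool" where
  "disjoint_elements x y \<longleftrightarrow> ubs UNIV {x + y, - x - y} = ubs UNIV {x - y, - x + y}"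

definition atom :: "'a::ordered_real_vector \<Rightarrow> bool" where
  "atom a \<longleftrightarrow> 0 \<le> a \<and> a \<noteq> 0 \<and>
     (\<forall>x. 0 \<le> x \<and> x \<le> a \<longrightarrow> (\<exists>c::real. 0 \<le> c \<and> x = c *\<^sub>R a))"

definition discrete_element :: "'a::ordered_real_vector \<Rightarrow> bool" where
  "discrete_element a \<longleftrightarrow> 0 < a \<and>
     (\<forall>x z. 0 \<le> x \<and> 0 \<le> z \<and> x \<le> a \<and> z \<le> a \<and> disjoint_elements x z \<longrightarrow> x = 0 \<or> z = 0)"

end

theory Submission
  imports Defs
begin

text \<open>
  Two positive disjoint elements \<open>x\<close>, \<open>z\<close> of an ordered vector space have no common positive
  lower bound other than \<open>0\<close> (\<open>disjoint_elements_positive_lower_bound\<close>).  If \<open>a\<close> is an atom and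
  \<open>x\<close>, \<open>z\<close> lie in \<open>[0, a]\<close>, then \<open>x = s a\<close> and \<open>z = t a\<close> with \<open>s, t \<ge> 0\<close>, and \<open>(min s t) a\<close> is
  such a common lower bound; hence \<open>min s t = 0\<close>, and \<open>x\<close> or \<open>z\<close> vanishes.
\<close>

lemma disjoint_elements_positive_lower_bound:
  fixes w x z :: "'a::ordered_real_vector"
  assumes disj: "disjoint_elements x z"
    and "0 \<le> w" "w \<le> x" "w \<le> z"
  shows "w = 0"
proof -
  \<comment> \<open>In a vector lattice, the bound below says \<open>\<bar>x - z\<bar> \<le> x + z - 2 w\<close>.\<close>
  have "w + w \<le> z + z" "w + w \<le> x + x"
    using assms by (auto intro: add_mono)
  then have "x + z - (w + w) \<in> ubs UNIV {x - z, - x + z}"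
    by (simp add: ubs_def isUb_def setle_def algebra_simps)
  then have "x + z - (w + w) \<in> ubs UNIV {x + z, - x - z}"
    using disj by (simp add: disjoint_elements_def)
  then have "x + z \<le> x + z - (w + w)"
    by (simp add: ubs_def isUb_def setle_def)
  then have "w + w \<le> 0"
    by (simp add: algebra_simps)
  moreover have "w \<le> w + w"
    using \<open>0 \<le> w\<close> by simp
  ultimately have "w \<le> 0"
    by (rule order_trans[rotated])
  with \<open>0 \<le> w\<close> show ?thesis
    by (rule order.antisym[rotated])
qed

theorem proposition30:
  fixes a :: "'x::ordered_real_vector"
  assumes "pre_Riesz_space TYPE('x) TYPE('y::{ordered_real_vector,lattice})"
    and "atom a"
  shows "discrete_element a"
  unfolding discrete_element_def
proof (intro conjI allI impI)
  show "0 < a"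
    using \<open>atom a\<close> by (simp add: atom_def order.not_eq_order_implies_strict)
next
  fix x z
  assume xz: "0 \<le> x \<and> 0 \<le> z \<and> x \<le> a \<and> z \<le> a \<and> disjoint_elements x z"
  have "0 \<le> a" "a \<noteq> 0"
    using \<open>atom a\<close> by (auto simp: atom_def)
  obtain s t :: real where s: "0 \<le> s" "x = s *\<^sub>R a" and t: "0 \<le> t" "z = t *\<^sub>R a"
    using \<open>atom a\<close> xz unfolding atom_def by meson
  have "min s t *\<^sub>R a = 0"
  proof (rule disjoint_elements_positive_lower_bound)
    show "disjoint_elements x z"
      using xz by simp
    show "0 \<le> min s t *\<^sub>R a"
      using s(1) t(1) \<open>0 \<le> a\<close> by (intro scaleR_nonneg_nonneg) auto
    show "min s t *\<^sub>R a \<le> x" "min s t *\<^sub>R a \<le> z"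
      unfolding s(2) t(2) using \<open>0 \<le> a\<close> by (auto intro: scaleR_right_mono)
  qed
  then have "min s t = 0"
    using \<open>a \<noteq> 0\<close> by simp
  then show "x = 0 \<or> z = 0"
    using s(2) t(2) by (auto simp: min_def split: if_splits)
qed

end
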